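(* Let $\Gamma\subset\mathbb{C}$ be a simple closed curve, $D=\Gamma\cup\operatorname{Int}(\Gamma)$, and let $f,g\in\mathcal{M}(D)$. Then the following are equivalent: (i) $f\perp_B g$, i.e. $\|f+\lambda g\|\ge\|f\|$ for all $\lambda\in\mathbb{C}$. (ii) The set $\{((f_Q(z),g_Q(z)),(f_R(w),g_R(w))) : (z,w)\in M_{f_Q}\times M_{f_R}\}\subseteq\mathbb{C}^2\times\mathbb{C}^2$ is an extended orthogonality covering set (EOCS).
   Context: $\Gamma$ is a simple closed curve in $\mathbb{C}$, $\operatorname{Int}(\Gamma)$ is the bounded region it encloses, and $D:=\Gamma\cup\operatorname{Int}(\Gamma)$ (a compact set). $\mathcal{M}(D)$ is the complex vector space of all meromorphic functions on $D$ under the usual operations (as usual, meromorphic/analytic on the closed set $D$ means meromorphic/analytic on some open neighbourhood of $D$, functions agreeing on $D$ being identified). For $f\in\mathcal{M}(D)$, let $z_i\in D$ be its (finitely many) poles in $D$, of order $n_i$, and let $\sum_{j=1}^{n_i}\frac{a_{ij}}{(z-z_i)^j}$ be the principal part of $f$ at $z_i$. Put $$f_P(z):=\sum_{z_i\in D}\sum_{j=1}^{n_i}\frac{a_{ij}}{(z-z_i)^j},\qquad f_R(z):=f(z)-f_P(z),\qquad f_Q(z):=\sum_{z_i\in D}\sum_{j=1}^{n_i}a_{ij}(z-z_i)^j .$$ Thus $f_R$ is analytic on $D$ and $f_Q$ is a polynomial (both sums are $0$ if $f$ has no pole in $D$). Define $$\|f_Q\|:=\sup_{z\in D}|f_Q(z)|,\quad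 \|f_R\|:=\sup_{z\in D}|f_R(z)|,\quad \|f\|:=\|f_Q\|+\|f_R\|,$$ which is the norm used on $\mathcal{M}(D)$, and $$M_{f_Q}:=\{z\in D:|f_Q(z)|=\|f_Q\|\},\qquad M_{f_R}:=\{z\in D:|f_R(z)|=\|f_R\|\}.$$ A subset $\mathcal{A}\subseteq\mathbb{C}^2\times\mathbb{C}^2$ is an extended orthogonality covering set (EOCS) if $$\mathbb{C}=\bigcup_{((z,w),(u,v))\in\mathcal{A}}\{\lambda\in\mathbb{C}:|z+\lambda w|+|u+\lambda v|\ge|z|+|u|\}.$$ *)

theory Defs
  imports "HOL-Complex_Analysis.Complex_Analysis"
begin

(* A meromorphic function is represented by a total function which is continuous at each regular
   point and takes the conventional value 0 at each pole. *)
definition mero_space :: "complex set \<Rightarrow> (complex \<Rightarrow> complex) set" where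
  "mero_space D = {f. \<exists>U. open U \<and> D \<subseteq> U \<and> f nicely_meromorphic_on U}"

(* The pointwise sum is wrong at poles, in particular where two poles cancel; remove_sings
   inserts the limit where it exists and 0 at the remaining poles. *)
definition mero_add :: "(complex \<Rightarrow> complex) \<Rightarrow> (complex \<Rightarrow> complex) \<Rightarrow> complex \<Rightarrow> complex" where
  "mero_add f g = remove_sings (\<lambda>z. f z + g z)"

definition mero_scale :: "complex \<Rightarrow> (complex \<Rightarrow> complex) \<Rightarrow> complex \<Rightarrow> complex" where
  "mero_scale c f = (\<lambda>z. c * f z)"

definition poles_in :: "complex set \<Rightarrow> (complex \<Rightarrow> complex) \<Rightarrow> complex set" where
  "poles_in D f = {p \<in> D. is_pole f p}"

(* The library's zorder is negative at poles. *)
definition pole_order :: "(complex \<Rightarrow> complex) \<Rightarrow> complex \<Rightarrow> nat" where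
  "pole_order f p = nat (- zorder f p)"

definition pp_coeff :: "(complex \<Rightarrow> complex) \<Rightarrow> complex \<Rightarrow> nat \<Rightarrow> complex" where
  "pp_coeff f p j = fls_nth (laurent_expansion f p) (- int j)"

definition part_P :: "complex set \<Rightarrow> (complex \<Rightarrow> complex) \<Rightarrow> complex \<Rightarrow> complex" where
  "part_P D f z = (\<Sum>p\<in>poles_in D f. \<Sum>j=1..pole_order f p. pp_coeff f p j / (z - p) ^ j)"

definition part_Q :: "complex set \<Rightarrow> (complex \<Rightarrow> complex) \<Rightarrow> complex \<Rightarrow> complex" where
  "part_Q D f z = (\<Sum>p\<in>poles_in D f. \<Sum>j=1..pole_order f p. pp_coeff f p j * (z - p) ^ j)"

(* At the poles of f in D, the singularity of f - f_P is removable and has to be filled in. *)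
definition part_R :: "complex set \<Rightarrow> (complex \<Rightarrow> complex) \<Rightarrow> complex \<Rightarrow> complex" where
  "part_R D f = remove_sings (\<lambda>z. f z - part_P D f z)"

definition sup_norm_on :: "complex set \<Rightarrow> (complex \<Rightarrow> complex) \<Rightarrow> real" where
  "sup_norm_on D h = (SUP z\<in>D. cmod (h z))"

definition mero_norm :: "complex set \<Rightarrow> (complex \<Rightarrow> complex) \<Rightarrow> real" where
  "mero_norm D f = sup_norm_on D (part_Q D f) + sup_norm_on D (part_R D f)"

definition max_modulus_set :: "complex set \<Rightarrow> (complex \<Rightarrow> complex) \<Rightarrow> complex set" where
  "max_modulus_set D h = {z \<in> D. cmod (h z) = sup_norm_on D h}"

definition BJ_orthogonal :: "complex set \<Rightarrow> (complex \<Rightarrow> complex) \<Rightarrow> (complex \<Rightarrow> complex) \<Rightarrow> bool" where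
  "BJ_orthogonal D f g \<longleftrightarrow>
     (\<forall>c::complex. mero_norm D (mero_add f (mero_scale c g)) \<ge> mero_norm D f)"

definition EOCS :: "((complex \<times> complex) \<times> (complex \<times> complex)) set \<Rightarrow> bool" where
  "EOCS A \<longleftrightarrow>
     (UNIV :: complex set) =
       (\<Union>((z, w), (u, v))\<in>A. {c. cmod (z + c * w) + cmod (u + c * v) \<ge> cmod z + cmod u})"

end

theory Submission
  imports Defs
begin

text \<open>Laurent coefficients at a fixed point are linear in the function, hence so are \<open>f \<mapsto> f\<^sub>Q\<close> and
  \<open>f \<mapsto> f\<^sub>R\<close> on \<open>D\<close>. This turns the claim into a statement about two pairs of continuous functions on
  the compact set \<open>D\<close> and the sum of two sup norms, and the analytic structure plays no further role.\<close>

section \<open>Sup norms of continuous functions on a compact set, and orthogonality for a sum of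
  two of them\<close>

lemma sup_norm_on_upper:
  assumes "compact D" "continuous_on D h" "z \<in> D"
  shows "cmod (h z) \<le> sup_norm_on D h"
  unfolding sup_norm_on_def
  by (intro cSUP_upper assms bounded_imp_bdd_above compact_imp_bounded compact_continuous_image
      continuous_intros)

lemma sup_norm_on_least:
  assumes "D \<noteq> {}" "\<And>z. z \<in> D \<Longrightarrow> cmod (h z) \<le> B"
  shows "sup_norm_on D h \<le> B"
  unfolding sup_norm_on_def by (intro cSUP_least assms)

lemma max_modulus_set_nonempty:
  assumes "compact D" "D \<noteq> {}" "continuous_on D h"
  shows "max_modulus_set D h \<noteq> {}"
proof -
  obtain z where z: "z \<in> D" "\<And>w. w \<in> D \<Longrightarrow> cmod (h w) \<le> cmod (h z)"
    using continuous_attains_sup[of D "\<lambda>z. cmod (h z)"] assms by (auto intro: continuous_intros)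
  then have "sup_norm_on D h = cmod (h z)"
    using assms by (intro antisym sup_norm_on_least sup_norm_on_upper) auto
  then show ?thesis using z by (auto simp: max_modulus_set_def)
qed

lemma compact_max_modulus_set:
  assumes "compact D" "continuous_on D h"
  shows "compact (max_modulus_set D h)"
proof -
  have "closedin (top_of_set D) {z \<in> D. cmod (h z) = sup_norm_on D h}"
    by (intro continuous_closedin_preimage_constant continuous_intros assms)
  then show ?thesis
    unfolding max_modulus_set_def using assms(1) closedin_compact by blast
qed

text \<open>The one-sided derivative of the sup norm at \<open>u\<close> in direction \<open>v\<close> is governed by the points
  where \<open>u\<close> attains its norm: near those points convexity of the modulus in \<open>t\<close> gives the bound,
  and away from them the modulus of \<open>u\<close> stays below its supremum by a fixed gap.\<close>

lemma sup_norm_on_perturbation: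
  assumes D: "compact D" "D \<noteq> {}" and u: "continuous_on D u" and v: "continuous_on D v"
    and less: "\<And>z. z \<in> max_modulus_set D u \<Longrightarrow> cmod (u z + v z) < sup_norm_on D u + b"
  shows "\<forall>\<^sub>F t in at_right 0. sup_norm_on D (\<lambda>z. u z + complex_of_real t * v z)
           \<le> sup_norm_on D u + t * b"
proof -
  \<comment> \<open>\<open>K\<close> collects the points where the full step t = 1 breaks the bound.
    By \<open>less\<close> it misses \<open>max_modulus_set D u\<close>, so compactness yields a gap
    m < \<open>sup_norm_on D u\<close> on it; if \<open>K\<close> is empty, any smaller m
    serves.\<close>
  define K where "K = {z \<in> D. sup_norm_on D u + b \<le> cmod (u z + v z)}"
  have "closedin (top_of_set D) (D \<inter> (\<lambda>z. cmod (u z + v z)) -` {sup_norm_on D u + b..})"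
    by (intro continuous_closedin_preimage continuous_intros u v)
  moreover have "D \<inter> (\<lambda>z. cmod (u z + v z)) -` {sup_norm_on D u + b..} = K"
    by (auto simp: K_def)
  ultimately have K: "compact K"
    using D(1) closedin_compact by metis
  have "\<exists>m < sup_norm_on D u. \<forall>z\<in>K. cmod (u z) \<le> m"
  proof (cases "K = {}")
    case True
    then show ?thesis using lt_ex by blast
  next
    case False
    have "continuous_on K (\<lambda>z. cmod (u z))"
      by (intro continuous_intros continuous_on_subset[OF u]) (auto simp: K_def)
    then obtain x where x: "x \<in> K" "\<And>z. z \<in> K \<Longrightarrow> cmod (u z) \<le> cmod (u x)"
      using continuous_attains_sup[OF K False] by blast
    have "x \<in> D" "x \<notin> max_modulus_set D u"
      using x(1) less[of x] by (auto simp: K_def)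
    then have "cmod (u x) < sup_norm_on D u"
      using sup_norm_on_upper[OF D(1) u, of x] by (auto simp: max_modulus_set_def)
    then show ?thesis using x(2) by blast
  qed
  then obtain m where m: "m < sup_norm_on D u" "\<And>z. z \<in> K \<Longrightarrow> cmod (u z) \<le> m" by blast
  let ?C = "sup_norm_on D v"
  \<comment> \<open>On \<open>K\<close> the modulus of u + t v is at most m + t \<open>?C\<close>.
    At t = 0 this lies strictly below the target, so it stays below for small t, whatever the sign
    of b.\<close>
  have "((\<lambda>t. sup_norm_on D u + t * b - (m + t * ?C)) \<longlongrightarrow> sup_norm_on D u + 0 * b - (m + 0 * ?C))
          (at_right 0)"
    by (intro tendsto_intros)
  then have "\<forall>\<^sub>F t in at_right 0. 0 < sup_norm_on D u + t * b - (m + t * ?C)"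
    by (rule order_tendstoD) (use m(1) in simp)
  moreover have "\<forall>\<^sub>F t :: real in at_right 0. t \<in> {0<..<1}"
    by (rule eventually_at_right_real) simp
  ultimately show ?thesis
  proof eventually_elim
    case (elim t)
    show ?case
    proof (rule sup_norm_on_least[OF D(2)])
      fix z assume z: "z \<in> D"
      note bounds = sup_norm_on_upper[OF D(1) u z] sup_norm_on_upper[OF D(1) v z]
      show "cmod (u z + complex_of_real t * v z) \<le> sup_norm_on D u + t * b"
      proof (cases "z \<in> K")
        case True
        have "cmod (u z + complex_of_real t * v z) \<le> cmod (u z) + t * cmod (v z)"
          using norm_triangle_ineq[of "u z" "complex_of_real t * v z"] elim(2)
          by (simp add: norm_mult)
        also have "\<dots> \<le> m + t * ?C"
          using m(2)[OF True] bounds elim(2) by (intro add_mono mult_left_mono) auto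
        finally show ?thesis using elim(1) by simp
      next
        case False
        have "u z + complex_of_real t * v z
                = complex_of_real (1 - t) * u z + complex_of_real t * (u z + v z)"
          by (simp add: algebra_simps)
        also have "cmod \<dots> \<le> (1 - t) * cmod (u z) + t * cmod (u z + v z)"
          using elim(2) by (intro norm_triangle_le) (simp add: norm_mult del: of_real_diff)
        also have "\<dots> \<le> (1 - t) * sup_norm_on D u + t * (sup_norm_on D u + b)"
          using bounds elim(2) False z
          by (intro add_mono mult_left_mono) (auto simp: K_def)
        also have "\<dots> = sup_norm_on D u + t * b" by (simp add: algebra_simps)
        finally show ?thesis .
      qed
    qed
  qed
qed

text \<open>If \<open>A\<close> does not cover \<open>c\<close>, the perturbation of \<open>u\<^sub>1\<close>, \<open>u\<^sub>2\<close> by \<open>t c\<close> with small \<open>t > 0\<close>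
  lowers the sum of the two norms.\<close>

lemma sup_norm_sum_orthogonal_iff_EOCS:
  assumes D: "compact D" "D \<noteq> {}"
    and cont: "continuous_on D u\<^sub>1" "continuous_on D v\<^sub>1" "continuous_on D u\<^sub>2" "continuous_on D v\<^sub>2"
  shows "(\<forall>c. sup_norm_on D u\<^sub>1 + sup_norm_on D u\<^sub>2
            \<le> sup_norm_on D (\<lambda>z. u\<^sub>1 z + c * v\<^sub>1 z) + sup_norm_on D (\<lambda>z. u\<^sub>2 z + c * v\<^sub>2 z)) \<longleftrightarrow>
    EOCS {((u\<^sub>1 z, v\<^sub>1 z), (u\<^sub>2 w, v\<^sub>2 w)) | z w.
            (z, w) \<in> max_modulus_set D u\<^sub>1 \<times> max_modulus_set D u\<^sub>2}"
    (is "?L \<longleftrightarrow> EOCS ?A")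
proof -
  have covered_iff: "EOCS ?A \<longleftrightarrow> (\<forall>c. \<exists>z\<in>max_modulus_set D u\<^sub>1. \<exists>w\<in>max_modulus_set D u\<^sub>2.
      cmod (u\<^sub>1 z) + cmod (u\<^sub>2 w) \<le> cmod (u\<^sub>1 z + c * v\<^sub>1 z) + cmod (u\<^sub>2 w + c * v\<^sub>2 w))"
    unfolding EOCS_def set_eq_iff by (simp add: Bex_def) metis
  show ?thesis
  proof
    assume "EOCS ?A"
    show ?L
    proof
      fix c
      obtain z w where zw: "z \<in> max_modulus_set D u\<^sub>1" "w \<in> max_modulus_set D u\<^sub>2"
        "cmod (u\<^sub>1 z) + cmod (u\<^sub>2 w) \<le> cmod (u\<^sub>1 z + c * v\<^sub>1 z) + cmod (u\<^sub>2 w + c * v\<^sub>2 w)"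
        using \<open>EOCS ?A\<close> covered_iff by blast
      have "cmod (u\<^sub>1 z + c * v\<^sub>1 z) \<le> sup_norm_on D (\<lambda>z. u\<^sub>1 z + c * v\<^sub>1 z)"
        "cmod (u\<^sub>2 w + c * v\<^sub>2 w) \<le> sup_norm_on D (\<lambda>z. u\<^sub>2 z + c * v\<^sub>2 z)"
        using zw(1,2) by (auto intro!: sup_norm_on_upper[of D "\<lambda>z. u\<^sub>1 z + c * v\<^sub>1 z"]
            sup_norm_on_upper[of D "\<lambda>z. u\<^sub>2 z + c * v\<^sub>2 z"] D cont continuous_intros
            simp: max_modulus_set_def)
      then show "sup_norm_on D u\<^sub>1 + sup_norm_on D u\<^sub>2
          \<le> sup_norm_on D (\<lambda>z. u\<^sub>1 z + c * v\<^sub>1 z) + sup_norm_on D (\<lambda>z. u\<^sub>2 z + c * v\<^sub>2 z)"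
        using zw by (auto simp: max_modulus_set_def)
    qed
  next
    assume ?L
    show "EOCS ?A"
    proof (rule ccontr)
      assume "\<not> EOCS ?A"
      then obtain c where "\<forall>z\<in>max_modulus_set D u\<^sub>1. \<forall>w\<in>max_modulus_set D u\<^sub>2.
          cmod (u\<^sub>1 z + c * v\<^sub>1 z) + cmod (u\<^sub>2 w + c * v\<^sub>2 w) < cmod (u\<^sub>1 z) + cmod (u\<^sub>2 w)"
        unfolding covered_iff by (meson not_le)
      then have c: "cmod (u\<^sub>1 z + c * v\<^sub>1 z) + cmod (u\<^sub>2 w + c * v\<^sub>2 w)
            < sup_norm_on D u\<^sub>1 + sup_norm_on D u\<^sub>2"
        if "z \<in> max_modulus_set D u\<^sub>1" "w \<in> max_modulus_set D u\<^sub>2" for z w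
        using that by (auto simp: max_modulus_set_def)
      \<comment> \<open>The strict inequality couples z and w. Taking the worst point of each
        maximum set separately splits it into one bound per summand.\<close>
      have attained: "\<exists>z\<in>max_modulus_set D u. \<forall>x\<in>max_modulus_set D u.
          cmod (u x + c * v x) \<le> cmod (u z + c * v z)"
        if "continuous_on D u" "continuous_on D v" for u v
      proof (rule continuous_attains_sup)
        show "continuous_on (max_modulus_set D u) (\<lambda>x. cmod (u x + c * v x))"
          by (intro continuous_intros continuous_on_subset[OF that(1)]
              continuous_on_subset[OF that(2)]) (auto simp: max_modulus_set_def)
      qed (intro compact_max_modulus_set max_modulus_set_nonempty D that)+
      obtain z where z: "z \<in> max_modulus_set D u\<^sub>1"
        "\<And>x. x \<in> max_modulus_set D u\<^sub>1 \<Longrightarrow> cmod (u\<^sub>1 x + c * v\<^sub>1 x) \<le> cmod (u\<^sub>1 z + c * v\<^sub>1 z)"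
        using attained[OF cont(1,2)] by blast
      obtain w where w: "w \<in> max_modulus_set D u\<^sub>2"
        "\<And>x. x \<in> max_modulus_set D u\<^sub>2 \<Longrightarrow> cmod (u\<^sub>2 x + c * v\<^sub>2 x) \<le> cmod (u\<^sub>2 w + c * v\<^sub>2 w)"
        using attained[OF cont(3,4)] by blast
      \<comment> \<open>These are the largest changes under the step c over each maximum set. Only
        their sum is known to be negative; one of them may be positive.\<close>
      define b\<^sub>1 b\<^sub>2 where "b\<^sub>1 = cmod (u\<^sub>1 z + c * v\<^sub>1 z) - sup_norm_on D u\<^sub>1"
        and "b\<^sub>2 = cmod (u\<^sub>2 w + c * v\<^sub>2 w) - sup_norm_on D u\<^sub>2"
      \<comment> \<open>A third of the total decrease: each summand spends one \<open>e\<close> to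
        obtain the strict bound required by the perturbation lemma, and
        \<open>b\<^sub>1 + b\<^sub>2 + 2 * e = - e\<close> is still negative.\<close>
      define e where "e = - (b\<^sub>1 + b\<^sub>2) / 3"
      have e: "e > 0" "b\<^sub>1 + b\<^sub>2 = - 3 * e"
        using c[OF z(1) w(1)] by (auto simp: e_def b\<^sub>1_def b\<^sub>2_def)
      have "\<forall>\<^sub>F t in at_right 0. sup_norm_on D (\<lambda>z. u\<^sub>1 z + complex_of_real t * (c * v\<^sub>1 z))
          \<le> sup_norm_on D u\<^sub>1 + t * (b\<^sub>1 + e)"
        using z(2) e(1) by (intro sup_norm_on_perturbation D cont continuous_intros)
          (force simp: b\<^sub>1_def)
      moreover have "\<forall>\<^sub>F t in at_right 0. sup_norm_on D (\<lambda>z. u\<^sub>2 z + complex_of_real t * (c * v\<^sub>2 z))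
          \<le> sup_norm_on D u\<^sub>2 + t * (b\<^sub>2 + e)"
        using w(2) e(1) by (intro sup_norm_on_perturbation D cont continuous_intros)
          (force simp: b\<^sub>2_def)
      moreover have "\<forall>\<^sub>F t :: real in at_right 0. t > 0"
        by (rule eventually_at_right_less)
      ultimately have "\<forall>\<^sub>F t :: real in at_right 0. False"
      proof eventually_elim
        case (elim t)
        have "sup_norm_on D u\<^sub>1 + sup_norm_on D u\<^sub>2
            \<le> sup_norm_on D (\<lambda>z. u\<^sub>1 z + complex_of_real t * (c * v\<^sub>1 z))
              + sup_norm_on D (\<lambda>z. u\<^sub>2 z + complex_of_real t * (c * v\<^sub>2 z))"
          using \<open>?L\<close>[rule_format, of "complex_of_real t * c"] by (simp add: mult.assoc)
        also have "\<dots> \<le> sup_norm_on D u\<^sub>1 + sup_norm_on D u\<^sub>2 + t * (b\<^sub>1 + b\<^sub>2 + 2 * e)"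
          using elim(1,2) by (simp add: algebra_simps)
        also have "t * (b\<^sub>1 + b\<^sub>2 + 2 * e) < 0"
          using e elim(3) by (simp add: mult_less_0_iff)
        finally show False by simp
      qed
      \<comment> \<open>\<open>at_right 0\<close> is a nontrivial filter, so \<open>False\<close>
        cannot hold eventually.\<close>
      then show False by simp
    qed
  qed
qed

section \<open>Coefficients of principal parts, and linearity of \<open>part_Q\<close> and
  \<open>part_P\<close>\<close>

lemma pp_coeff_eq_0:
  assumes "nat (- fls_subdegree (laurent_expansion f p)) < j"
  shows "pp_coeff f p j = 0"
  using assms unfolding pp_coeff_def by (intro fls_eq0_below_subdegree) linarith

text \<open>\<open>zorder\<close> is matched with the subdegree for a nonzero expansion. At a pole
  the subdegree is negative, which rules out the zero series, whose subdegree is 0 by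
  convention.\<close>

lemma pole_order_eq:
  assumes "f meromorphic_on D" "p \<in> poles_in D f"
  shows "pole_order f p = nat (- fls_subdegree (laurent_expansion f p))"
proof -
  have exp: "(\<lambda>w. f (p + w)) has_laurent_expansion laurent_expansion f p" and "is_pole f p"
    using assms meromorphic_on_imp_has_laurent_expansion by (auto simp: poles_in_def)
  then have "fls_subdegree (laurent_expansion f p) < 0"
    using is_pole_imp_neg_fls_subdegree by blast
  then have "laurent_expansion f p \<noteq> 0" by auto
  then show ?thesis
    using has_laurent_expansion_zorder[OF exp] by (simp add: pole_order_def)
qed

lemma finite_poles_in:
  assumes "f meromorphic_on D" "compact D"
  shows "finite (poles_in D f)"
proof -
  have "{p. is_pole f p} sparse_in D"
    using meromorphic_on_imp_not_pole_cosparse[OF assms(1)] by (simp add: eventually_cosparse)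
  then have "finite (D \<inter> {p. is_pole f p})"
    using assms(2) sparse_in_compact_finite by blast
  then show ?thesis by (simp add: poles_in_def Int_def)
qed

text \<open>The range of summation in \<open>part_P\<close> and \<open>part_Q\<close> depends on \<open>f\<close>; over a larger range the
  extra coefficients vanish.\<close>

lemma sum_pp_coeff_extend:
  fixes k :: "complex \<Rightarrow> nat \<Rightarrow> complex"
  assumes f: "f meromorphic_on D"
    and S: "finite S" "poles_in D f \<subseteq> S" "S \<subseteq> D"
    and N: "\<And>p. p \<in> S \<Longrightarrow> nat (- fls_subdegree (laurent_expansion f p)) \<le> N"
  shows "(\<Sum>p\<in>poles_in D f. \<Sum>j=1..pole_order f p. pp_coeff f p j * k p j)
       = (\<Sum>p\<in>S. \<Sum>j=1..N. pp_coeff f p j * k p j)"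
proof (rule sum.mono_neutral_cong_left)
  show "\<forall>p\<in>S - poles_in D f. (\<Sum>j=1..N. pp_coeff f p j * k p j) = 0"
  proof
    fix p assume p: "p \<in> S - poles_in D f"
    then have "(\<lambda>w. f (p + w)) has_laurent_expansion laurent_expansion f p" "\<not> is_pole f p"
      using S(3) f meromorphic_on_imp_has_laurent_expansion by (auto simp: poles_in_def)
    then have "fls_subdegree (laurent_expansion f p) \<ge> 0"
      using has_laurent_expansion_imp_is_pole not_le by blast
    then show "(\<Sum>j=1..N. pp_coeff f p j * k p j) = 0"
      by (intro sum.neutral) (auto simp: pp_coeff_eq_0)
  qed
next
  fix p assume p: "p \<in> poles_in D f"
  then have "pole_order f p \<le> N"
    using pole_order_eq[OF f p] N[of p] S(2) by auto
  then show "(\<Sum>j=1..pole_order f p. pp_coeff f p j * k p j) = (\<Sum>j=1..N. pp_coeff f p j * k p j)"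
    using pole_order_eq[OF f p]
    by (intro sum.mono_neutral_cong_left) (auto simp: pp_coeff_eq_0)
qed (use S in auto)

lemma ex_pole_order_bound:
  assumes "finite S"
  shows "\<exists>N. \<forall>p\<in>S. nat (- fls_subdegree (laurent_expansion f p)) \<le> N"
  using finite_imageI[OF assms, of "\<lambda>p. nat (- fls_subdegree (laurent_expansion f p))"]
  unfolding finite_nat_set_iff_bounded_le by blast

lemma mero_add_scale_meromorphic:
  assumes "f meromorphic_on D" "g meromorphic_on D"
  shows "mero_add f (mero_scale c g) meromorphic_on D"
  unfolding mero_add_def mero_scale_def by (intro meromorphic_intros assms)

text \<open>Near a point of \<open>D\<close> the pointwise sum has at most an isolated singularity,
  so \<open>remove_sings\<close> changes nothing in a small punctured disc. Laurent expansions and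
  limits see only that disc.\<close>

lemma eventually_mero_add_scale:
  assumes "f meromorphic_on D" "g meromorphic_on D" "z \<in> D"
  shows "\<forall>\<^sub>F w in at z. mero_add f (mero_scale c g) w = f w + c * g w"
proof -
  have "(\<lambda>w. f w + c * g w) meromorphic_on D"
    by (intro meromorphic_intros assms)
  then show ?thesis
    unfolding mero_add_def mero_scale_def using assms(3)
    by (intro eventually_remove_sings_eq_at meromorphic_on_isolated_singularity)
      (erule meromorphic_on_subset, simp)
qed

lemma pp_coeff_mero_add_scale:
  assumes "f meromorphic_on D" "g meromorphic_on D" "p \<in> D"
  shows "pp_coeff (mero_add f (mero_scale c g)) p j = pp_coeff f p j + c * pp_coeff g p j"
proof -
  have "laurent_expansion (mero_add f (mero_scale c g)) p = laurent_expansion (\<lambda>w. f w + c * g w) p"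
    by (intro laurent_expansion_cong eventually_mero_add_scale[OF assms] refl)
  also have "\<dots> = laurent_expansion f p + fls_const c * laurent_expansion g p"
    using assms by (intro laurent_expansion_eqI laurent_expansion_intros
        meromorphic_on_imp_has_laurent_expansion[where A = D])
  finally show ?thesis by (simp add: pp_coeff_def)
qed

text \<open>The arbitrary weight \<open>k\<close> treats \<open>part_Q\<close>, with weight (z -
  p)^j, and \<open>part_P\<close>, with its inverse, in one argument.\<close>

lemma sum_pp_coeff_mero_add_scale:
  fixes k :: "complex \<Rightarrow> nat \<Rightarrow> complex" and c :: complex
  defines "s \<equiv> \<lambda>D f. \<Sum>p\<in>poles_in D f. \<Sum>j=1..pole_order f p. pp_coeff f p j * k p j"
  assumes f: "f meromorphic_on D" and g: "g meromorphic_on D" and D: "compact D"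
  shows "s D (mero_add f (mero_scale c g)) = s D f + c * s D g"
proof -
  define h where "h = mero_add f (mero_scale c g)"
  have h: "h meromorphic_on D"
    unfolding h_def by (rule mero_add_scale_meromorphic[OF f g])
  \<comment> \<open>Poles of f and g may cancel or drop in order in h, so the three sums have
    different ranges. A common \<open>S\<close> and \<open>N\<close> make them comparable
    termwise.\<close>
  define S where "S = poles_in D f \<union> poles_in D g \<union> poles_in D h"
  have S: "finite S" "S \<subseteq> D"
    using finite_poles_in f g h D by (auto simp: S_def poles_in_def)
  obtain Nf Ng Nh where N:
    "\<And>p. p \<in> S \<Longrightarrow> nat (- fls_subdegree (laurent_expansion f p)) \<le> Nf"
    "\<And>p. p \<in> S \<Longrightarrow> nat (- fls_subdegree (laurent_expansion g p)) \<le> Ng"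
    "\<And>p. p \<in> S \<Longrightarrow> nat (- fls_subdegree (laurent_expansion h p)) \<le> Nh"
    using ex_pole_order_bound[OF S(1)] by metis
  define N where "N = max Nf (max Ng Nh)"
  have "s D q = (\<Sum>p\<in>S. \<Sum>j=1..N. pp_coeff q p j * k p j)" if "q \<in> {f, g, h}" for q
    unfolding s_def using that N f g h S
    by (intro sum_pp_coeff_extend) (auto simp: S_def N_def le_max_iff_disj)
  then have eqs: "s D f = (\<Sum>p\<in>S. \<Sum>j=1..N. pp_coeff f p j * k p j)"
    "s D g = (\<Sum>p\<in>S. \<Sum>j=1..N. pp_coeff g p j * k p j)"
    "s D h = (\<Sum>p\<in>S. \<Sum>j=1..N. pp_coeff h p j * k p j)"
    by auto
  have "s D h = (\<Sum>p\<in>S. \<Sum>j=1..N. pp_coeff f p j * k p j + c * (pp_coeff g p j * k p j))"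
    unfolding eqs(3) using S(2) by (intro sum.cong refl)
      (auto simp: h_def pp_coeff_mero_add_scale[OF f g] algebra_simps)
  then show ?thesis
    by (simp add: eqs h_def sum.distrib sum_distrib_left)
qed

lemma part_Q_mero_add_scale:
  assumes "f meromorphic_on D" "g meromorphic_on D" "compact D"
  shows "part_Q D (mero_add f (mero_scale c g)) z = part_Q D f z + c * part_Q D g z"
  unfolding part_Q_def by (rule sum_pp_coeff_mero_add_scale[OF assms])

lemma part_P_mero_add_scale:
  assumes "f meromorphic_on D" "g meromorphic_on D" "compact D"
  shows "part_P D (mero_add f (mero_scale c g)) z = part_P D f z + c * part_P D g z"
  using sum_pp_coeff_mero_add_scale[OF assms, of c "\<lambda>p j. inverse ((z - p) ^ j)"]
  by (simp add: part_P_def divide_inverse)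

section \<open>Continuity of \<open>part_Q\<close> and \<open>part_R\<close>, and linearity of
  \<open>part_R\<close>\<close>

lemma continuous_on_part_Q: "continuous_on A (part_Q D f)"
  unfolding part_Q_def by (intro continuous_intros)

text \<open>The subtracted terms cancel every negative Laurent coefficient, and an expansion of
  nonnegative subdegree gives a limit. \<open>N\<close> may exceed the order of the pole, and z may
  be regular.\<close>

lemma has_limit_minus_principal_part:
  assumes f: "(\<lambda>w. f (z + w)) has_laurent_expansion laurent_expansion f z"
    and N: "nat (- fls_subdegree (laurent_expansion f z)) \<le> N"
  shows "\<exists>l. (\<lambda>w. f w - (\<Sum>j=1..N. pp_coeff f z j / (w - z) ^ j)) \<midarrow>z\<rightarrow> l"
proof -
  let ?F = "laurent_expansion f z"
  let ?P = "\<Sum>j=1..N. fls_const (pp_coeff f z j) * fls_X_intpow (- int j)"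
  have "(\<lambda>w. f (z + w) - (\<Sum>j=1..N. pp_coeff f z j * w powi (- int j))) has_laurent_expansion ?F - ?P"
    by (intro laurent_expansion_intros f)
  then have exp: "(\<lambda>w. f (z + w) - (\<Sum>j=1..N. pp_coeff f z j / (z + w - z) ^ j))
      has_laurent_expansion ?F - ?P"
    by (simp add: power_int_minus divide_inverse)
  have "fls_subdegree (?F - ?P) \<ge> 0"
  proof (rule fls_subdegree_ge0I)
    fix k :: int assume "k < 0"
    define i where "i = nat (- k)"
    have i: "k = - int i" "i \<ge> 1"
      using \<open>k < 0\<close> by (auto simp: i_def)
    have "fls_nth ?P k = (\<Sum>j=1..N. if i = j then pp_coeff f z j else 0)"
      unfolding fls_nth_sum by (intro sum.cong) (auto simp: i)
    \<comment> \<open>If i > \<open>N\<close>, the sum is empty of matching terms, but then the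
      coefficient itself vanishes.\<close>
    also have "\<dots> = pp_coeff f z i"
      using i(2) N pp_coeff_eq_0[of f z i] by (auto simp: not_le)
    finally show "fls_nth (?F - ?P) k = 0"
      by (simp add: pp_coeff_def i)
  qed
  from has_laurent_expansion_imp_tendsto[OF exp this] show ?thesis by blast
qed

text \<open>Only the principal part at z itself is singular there; the terms from other poles are
  continuous at z. Describing \<open>part_R\<close> as a limit avoids the conventional values of f
  and of division by zero at the poles.\<close>

lemma tendsto_part_R:
  assumes f: "f meromorphic_on D" and D: "compact D" and z: "z \<in> D"
  shows "(\<lambda>w. f w - part_P D f w) \<midarrow>z\<rightarrow> part_R D f z"
proof -
  \<comment> \<open>Inserting z treats poles and regular points alike: at a regular point the added
    coefficients are 0.\<close>
  define S where "S = insert z (poles_in D f)"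
  have S: "finite S" "poles_in D f \<subseteq> S" "S \<subseteq> D"
    using finite_poles_in[OF f D] z by (auto simp: S_def poles_in_def)
  obtain N where N: "\<And>p. p \<in> S \<Longrightarrow> nat (- fls_subdegree (laurent_expansion f p)) \<le> N"
    using ex_pole_order_bound[OF S(1)] by metis
  have P: "part_P D f w = (\<Sum>p\<in>S. \<Sum>j=1..N. pp_coeff f p j / (w - p) ^ j)" for w
    using sum_pp_coeff_extend[OF f S N, of "\<lambda>p j. inverse ((w - p) ^ j)"]
    by (simp add: part_P_def divide_inverse)
  let ?pp = "\<lambda>w. \<Sum>j=1..N. pp_coeff f z j / (w - z) ^ j"
  let ?rest = "\<lambda>w. \<Sum>p\<in>S - {z}. \<Sum>j=1..N. pp_coeff f p j / (w - p) ^ j"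
  obtain l where "(\<lambda>w. f w - ?pp w) \<midarrow>z\<rightarrow> l"
    using has_limit_minus_principal_part[OF meromorphic_on_imp_has_laurent_expansion[OF f z], of N]
      N[of z] by (auto simp: S_def)
  moreover have "?rest \<midarrow>z\<rightarrow> ?rest z"
    by (intro tendsto_intros) auto
  ultimately have "(\<lambda>w. f w - ?pp w - ?rest w) \<midarrow>z\<rightarrow> l - ?rest z"
    by (rule tendsto_diff)
  moreover have "part_P D f w = ?pp w + ?rest w" for w
    unfolding P using S(1) by (intro sum.remove) (simp_all add: S_def)
  ultimately have lim: "(\<lambda>w. f w - part_P D f w) \<midarrow>z\<rightarrow> l - ?rest z"
    by (simp add: diff_diff_eq)
  then have "part_R D f z = l - ?rest z"
    unfolding part_R_def by (rule remove_sings_eqI)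
  then show ?thesis
    using lim by simp
qed

text \<open>Both sides are limits at z of functions that agree in a punctured neighbourhood, even
  where z is a pole.\<close>

lemma part_R_mero_add_scale:
  assumes fg: "f meromorphic_on D" "g meromorphic_on D" and D: "compact D" and z: "z \<in> D"
  shows "part_R D (mero_add f (mero_scale c g)) z = part_R D f z + c * part_R D g z"
proof -
  have "(\<lambda>w. (f w - part_P D f w) + c * (g w - part_P D g w)) \<midarrow>z\<rightarrow> part_R D f z + c * part_R D g z"
    by (intro tendsto_intros tendsto_part_R fg D z)
  moreover have "\<forall>\<^sub>F w in at z. (f w - part_P D f w) + c * (g w - part_P D g w)
      = mero_add f (mero_scale c g) w - part_P D (mero_add f (mero_scale c g)) w"
    using eventually_mero_add_scale[OF fg z, of c]
    by eventually_elim (simp add: part_P_mero_add_scale[OF fg D] algebra_simps)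
  ultimately show ?thesis
    unfolding part_R_def[of D "mero_add f (mero_scale c g)"]
    by (intro remove_sings_eqI) (rule Lim_transform_eventually)
qed

text \<open>An isolated singularity with a finite limit is removable, so the filled-in function is
  analytic at each point of \<open>D\<close>.\<close>

lemma continuous_on_part_R:
  assumes f: "f meromorphic_on D" and D: "compact D"
  shows "continuous_on D (part_R D f)"
proof (intro continuous_at_imp_continuous_on ballI)
  fix z assume z: "z \<in> D"
  have "(\<lambda>w. f w - part_P D f w) meromorphic_on D"
    unfolding part_P_def by (intro meromorphic_intros f)
  then have "isolated_singularity_at (\<lambda>w. f w - part_P D f w) z"
    using z by (intro meromorphic_on_isolated_singularity) (erule meromorphic_on_subset, simp)
  then have "part_R D f analytic_on {z}"
    unfolding part_R_def using tendsto_part_R[OF f D z] by (rule remove_sings_analytic_at)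
  then show "isCont (part_R D f) z"
    by (rule analytic_at_imp_isCont)
qed

theorem theorem2p1:
  fixes \<gamma> :: "real \<Rightarrow> complex" and \<Gamma> D :: "complex set" and f g :: "complex \<Rightarrow> complex"
  assumes "simple_path \<gamma>" and "pathfinish \<gamma> = pathstart \<gamma>"
    and "\<Gamma> = path_image \<gamma>"
    and "D = \<Gamma> \<union> inside \<Gamma>"
    and "f \<in> mero_space D" and "g \<in> mero_space D"
  shows "BJ_orthogonal D f g \<longleftrightarrow>
    EOCS {((part_Q D f z, part_Q D g z), (part_R D f w, part_R D g w)) | z w.
            (z, w) \<in> max_modulus_set D (part_Q D f) \<times> max_modulus_set D (part_R D f)}"
proof -
  have "compact \<Gamma>" "\<Gamma> \<noteq> {}" "closed D"
    using assms(1,3,4) by (auto simp: compact_simple_path_image closed_path_image_Un_inside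
        simple_path_imp_path)
  then have D: "compact D" "D \<noteq> {}"
    using assms(4) bounded_inside[of \<Gamma>] by (auto simp: compact_eq_bounded_closed)
  have fg: "f meromorphic_on D" "g meromorphic_on D"
    using assms(5,6) by (auto simp: mero_space_def nicely_meromorphic_on_def
        intro: meromorphic_on_subset)
  \<comment> \<open>Linearity of \<open>part_R\<close> is established at points of \<open>D\<close>,
    so the rewriting takes place under the supremum over \<open>D\<close> rather than between
    functions.\<close>
  have "mero_norm D (mero_add f (mero_scale c g))
      = sup_norm_on D (\<lambda>z. part_Q D f z + c * part_Q D g z)
        + sup_norm_on D (\<lambda>z. part_R D f z + c * part_R D g z)" for c
    unfolding mero_norm_def sup_norm_on_def
    by (simp add: part_Q_mero_add_scale part_R_mero_add_scale fg D cong: SUP_cong)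
  then have "BJ_orthogonal D f g \<longleftrightarrow>
      (\<forall>c. sup_norm_on D (part_Q D f) + sup_norm_on D (part_R D f)
        \<le> sup_norm_on D (\<lambda>z. part_Q D f z + c * part_Q D g z)
          + sup_norm_on D (\<lambda>z. part_R D f z + c * part_R D g z))"
    by (simp add: BJ_orthogonal_def mero_norm_def)
  then show ?thesis
    using sup_norm_sum_orthogonal_iff_EOCS[OF D continuous_on_part_Q continuous_on_part_Q
        continuous_on_part_R[OF fg(1) D(1)] continuous_on_part_R[OF fg(2) D(1)]]
    by simp
qed

end
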